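(* The macro--micro parallel BUG scheme (defined in the context) is locally conservative for zero or periodic boundary conditions. That is, let the scalar flux at time $t_n$ be denoted by $\Phi^n=B^n+\varepsilon^2h^n$ for $n\ge0$. Then the scheme fulfills the discrete conservation law $$\frac1{c\Delta t}\left(\Phi^{n+1}-\Phi^n\right)+\frac1{2\pi}\sum_{v\in\{x,y\}}\mathbf{D}^0_v\,X^{n+1}S^{n+1}V^{n+1,\top}Q_vw=-\Sigma^ah^{n+1},$$ $$\frac{c_\nu}{\Delta t}\left(T^{n+1}-T^n\right)=2\pi\Sigma^ah^{n+1}.$$
   Context: Constants: $\varepsilon,c,a,c_\nu,\Delta t,\Delta x,\Delta y>0$. Cross sections $\sigma^a(x)\ge\sigma^a_0>0$, $\sigma^t=\sigma^a+\sigma^s\ge\sigma^t_0>0$. Staggered grid: points $x_i,x_{i+1/2}$ (spacing $\Delta x$), $y_j,y_{j+1/2}$ (spacing $\Delta y$). $\mathcal{K}^C$: indices $(i,j)$ (cell centers) and $(i+\frac12,j+\frac12)$ (corners), $N^C$ of them; $\mathcal{K}^I$: indices $(i+\frac12,j)$ and $(i,j+\frac12)$ (interfaces), $N^I$ of them. $T,h\in\mathbb{R}^{N^C}$ are grid functions on $\mathcal{K}^C$; $\mathbf{g}\in\mathbb{R}^{N^I\times N_q}$ has rows $g_\kappa^\top$, $\kappa\in\mathcal{K}^I$. $B^n=B(T^n)=\frac{ac}{2\pi}(T^n)^4$ pointwise. $\Sigma^t$ is the diagonal matrix with entries $\sigma^t_\kappa$, $\kappa\in\mathcal{K}^I$;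 $\Sigma^a$ in the equations for $h,T$ is the diagonal matrix with entries $\sigma^a_\kappa$, $\kappa\in\mathcal{K}^C$. Angular discretization: product quadrature on the projected unit sphere with nodes $(\Omega_x^\ell,\Omega_y^\ell)$ and weights $w^\ell$, $\ell=1,\dots,N_q$; $w=(w^\ell)_\ell$, $\mathbb{1}=(1,\dots,1)^\top$, $Q_v=\mathrm{diag}(\Omega_v^\ell)$, $Q_v^\pm=(Q_v\pm|Q_v|)/2$, $v\in\{x,y\}$. Difference matrices: $\mathbf{D}^\pm_v\in\mathbb{R}^{N^I\times N^I}$, $\mathbf{d}^0_v\in\mathbb{R}^{N^I\times N^C}$, $\mathbf{D}^0_v\in\mathbb{R}^{N^C\times N^I}$ are the matrix forms of the operators, for $v=x$ (analogously for $y$): $\mathcal{D}^+_xg_{\alpha\beta}=\frac{g_{\alpha+1,\beta}-g_{\alpha\beta}}{\Delta x}$, $\mathcal{D}^-_xg_{\alpha\beta}=\frac{g_{\alpha\beta}-g_{\alpha-1,\beta}}{\Delta x}$, $\delta^0_xh_{\alpha\beta}=\frac{h_{\alpha+1/2,\beta}-h_{\alpha-1/2,\beta}}{\Delta x}$ for $(\alpha,\beta)\in\mathcal{K}^I$, and $\mathcal{D}^0_xg_{\alpha\beta}=\frac{g_{\alpha+1/2,\beta}-g_{\alpha-1/2,\beta}}{\Delta x}$ for $(\alpha,\beta)\in\mathcal{K}^C$. For a matrix $Y\in\mathbb{R}^{N^I\times N_q}$ set $\mathbf{L}Y=\sum_v(\mathbf{D}^+_vYQ_v^-+\mathbf{D}^-_vYQ_v^+)$,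 and write $R^n=\sum_v\mathbf{d}^0_v(B(T^n)+\varepsilon^2h^n)\mathbb{1}^\top Q_v$, $P=I-\frac1{2\pi}\mathbb{1}w^\top$. Macro--micro parallel BUG scheme, one step $t_n\to t_{n+1}=t_n+\Delta t$, starting from $T^n,h^n$ and the rank-$r_n$ factorization $\mathbf{g}^n=X^nS^nV^{n,\top}$ ($X^n,V^n$ with orthonormal columns): 1. Pre-augmentation: replace $X^n$ by an orthonormal basis of the columns of $[(\Sigma^t)^{-1}\mathbf{d}^0_xB(T^n),(\Sigma^t)^{-1}\mathbf{d}^0_yB(T^n),X^n]$ and $V^n$ by an orthonormal basis of the columns of $[Q_x\mathbb{1},Q_y\mathbb{1},V^n]$ with $V^{n,\top}w=0$; replace $S^n$ by the projection of the coefficients onto the new bases (so $X^nS^nV^{n,\top}$ is unchanged). The new factors are again denoted $X^n,S^n,V^n$; their rank is $\tilde r_n=r_n+2$. 2. Parallel update. K-step: with $K^n=X^nS^n$, $\frac{\varepsilon^2}{c\Delta t}(K^{n+1}-K^n)=-\varepsilon\,\mathbf{L}(K^nV^{n,\top})P^\top V^n-R^nV^n-\Sigma^tK^{n+1}$; let $\widehat X=(X^n,\widetilde X^{n+1})$ be an orthonormal basis of the columns of $(X^n,K^{n+1})$ and $\widetilde S^K=\widetilde X^{n+1,\top}K^{n+1}$. L-step: with $L^n=V^nS^{n,\top}$, $\frac{\varepsilon^2}{c\Delta t}(L^{n+1}-L^n)=-\varepsilon P(\mathbf{L}(X^nL^{n,\top}))^\top X^n-(R^n)^\top X^n-L^{n+1}X^{n,\top}\Sigma^tX^n$;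 let $\widehat V=(V^n,\widetilde V^{n+1})$ be an orthonormal basis of the columns of $(V^n,L^{n+1})$ with $\widetilde V^{n+1,\top}w=0$ and $\widetilde S^L=L^{n+1,\top}\widetilde V^{n+1}$. S-step: $\frac{\varepsilon^2}{c\Delta t}(\overline S^{n+1}-S^n)=-\varepsilon X^{n,\top}\mathbf{L}(X^nS^nV^{n,\top})P^\top V^n-X^{n,\top}R^nV^n-X^{n,\top}\Sigma^tX^n\overline S^{n+1}$. 3. Augmentation: $\widehat S=\begin{bmatrix}\overline S^{n+1}&\widetilde S^L\\\widetilde S^K&0\end{bmatrix}$. 4. Conservative truncation: $\widehat X\widehat S\widehat V^\top$ is truncated (up to a given tolerance, by an SVD-based truncation) to $\mathbf{g}^{n+1}=X^{n+1}S^{n+1}V^{n+1,\top}$ of rank $1\le r_{n+1}<2\tilde r_n$, in such a way that the pre-augmented basis vectors of step 1 are preserved in the ranges of $X^{n+1}$ and $V^{n+1}$. 5. Update of $h,T$: for all $\kappa\in\mathcal{K}^C$, with $g^{n+1}_\kappa$ the rows of $\mathbf{g}^{n+1}$ on $\mathcal{K}^I$, $\frac{\varepsilon^2}{c\Delta t}(h^{n+1}_\kappa-h^n_\kappa)+\frac1{c\Delta t}(B^{n+1}_\kappa-B^n_\kappa)+\frac1{2\pi}\sum_vw^\top Q_v\mathcal{D}^0_vg^{n+1}_\kappa=-\sigma^a_\kappa h^{n+1}_\kappa$ and $\frac{c_\nu}{\Delta t}(T^{n+1}_\kappa-T^n_\kappa)=2\pi\sigma^a_\kappa h^{n+1}_\kappa$.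 *)

theory Defs
  imports Complex_Main "Jordan_Normal_Form.VS_Connect"
begin

datatype boundary = Zero_bc | Periodic_bc

datatype axis = Axis_x | Axis_y

text \<open>
  Half-integer grid indices are stored doubled: the pair \<open>(p, q)\<close> of integers stands for the
  index \<open>(p/2, q/2)\<close>, i.e. for the point \<open>(org_x + p \<Delta>x/2, org_y + q \<Delta>y/2)\<close>. The bounds
  \<open>lo_x, hi_x, lo_y, hi_y\<close> are bounds for the doubled indices. \<open>enumC\<close> and \<open>enumI\<close> fix the
  (arbitrary) orders in which the two kinds of grid points label rows and columns of matrices.
\<close>

record discretization =
  eps :: real
  clight :: real
  arad :: real
  cnu :: real
  dt :: real
  dx :: real
  dy :: real
  bc :: boundary
  lo_x :: int
  hi_x :: int
  lo_y :: int
  hi_y :: int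
  org_x :: real
  org_y :: real
  enumC :: "nat \<Rightarrow> int \<times> int"
  enumI :: "nat \<Rightarrow> int \<times> int"
  spatial_dom :: "(real \<times> real) set"
  sigma_a :: "real \<times> real \<Rightarrow> real"
  sigma_s :: "real \<times> real \<Rightarrow> real"
  sigma_a0 :: real
  sigma_t0 :: real
  Nq :: nat
  Omega :: "axis \<Rightarrow> nat \<Rightarrow> real"
  weight :: "nat \<Rightarrow> real"

definition grid_box :: "discretization \<Rightarrow> (int \<times> int) set" where
  "grid_box D = {lo_x D..hi_x D} \<times> {lo_y D..hi_y D}"

text \<open>
  Cell centres \<open>(i, j)\<close> are the pairs with both doubled indices even, corners
  \<open>(i+1/2, j+1/2)\<close> those with both odd; interfaces have one of each.
\<close>

definition KC :: "discretization \<Rightarrow> (int \<times> int) set" where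
  "KC D = {\<kappa> \<in> grid_box D. (even (fst \<kappa>) \<and> even (snd \<kappa>)) \<or> (odd (fst \<kappa>) \<and> odd (snd \<kappa>))}"

definition KI :: "discretization \<Rightarrow> (int \<times> int) set" where
  "KI D = {\<kappa> \<in> grid_box D. (odd (fst \<kappa>) \<and> even (snd \<kappa>)) \<or> (even (fst \<kappa>) \<and> odd (snd \<kappa>))}"

definition NC :: "discretization \<Rightarrow> nat" where "NC D = card (KC D)"

definition NI :: "discretization \<Rightarrow> nat" where "NI D = card (KI D)"

definition grid_point :: "discretization \<Rightarrow> int \<times> int \<Rightarrow> real \<times> real" where
  "grid_point D \<kappa> = (org_x D + real_of_int (fst \<kappa>) * dx D / 2, org_y D + real_of_int (snd \<kappa>) * dy D / 2)"

definition sigma_t :: "discretization \<Rightarrow> real \<times> real \<Rightarrow> real" where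
  "sigma_t D z = sigma_a D z + sigma_s D z"

text \<open>
  A product rule: polar cosines \<open>\<mu>\<close> with weights \<open>\<alpha>\<close>, azimuthal angles \<open>\<phi>\<close> with weights \<open>\<beta>\<close>,
  the points on the sphere being projected to their first two coordinates; \<open>e\<close> is the numbering
  of the pairs. The weights are normalised to \<open>2 \<pi>\<close>, which is what makes
  \<open>I - 1/(2\<pi>) \<one> w\<^sup>T\<close> a projection.
\<close>

definition product_quadrature :: "nat \<Rightarrow> (axis \<Rightarrow> nat \<Rightarrow> real) \<Rightarrow> (nat \<Rightarrow> real) \<Rightarrow> bool" where
  "product_quadrature nq \<Omega> w \<longleftrightarrow>
     (\<exists>K J (\<mu> :: nat \<Rightarrow> real) (\<phi> :: nat \<Rightarrow> real) \<alpha> \<beta> e.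
        bij_betw e {..<nq} ({..<K} \<times> {..<J}) \<and>
        (\<forall>k<K. \<bar>\<mu> k\<bar> \<le> 1) \<and>
        (\<forall>l<nq. let (k, j) = e l in
           \<Omega> Axis_x l = sqrt (1 - (\<mu> k)\<^sup>2) * cos (\<phi> j) \<and>
           \<Omega> Axis_y l = sqrt (1 - (\<mu> k)\<^sup>2) * sin (\<phi> j) \<and>
           w l = \<alpha> k * \<beta> j)) \<and>
     (\<Sum>l<nq. w l) = 2 * pi"

text \<open>
  In the periodic case the box holds exactly one period, which therefore consists of full cells:
  an even number of doubled indices in each direction.
\<close>

definition valid_discretization :: "discretization \<Rightarrow> bool" where
  "valid_discretization D \<longleftrightarrow>
     eps D > 0 \<and> clight D > 0 \<and> arad D > 0 \<and> cnu D > 0 \<and> dt D > 0 \<and> dx D > 0 \<and> dy D > 0 \<and>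
     lo_x D \<le> hi_x D \<and> lo_y D \<le> hi_y D \<and>
     (bc D = Periodic_bc \<longrightarrow> even (hi_x D - lo_x D + 1) \<and> even (hi_y D - lo_y D + 1)) \<and>
     bij_betw (enumC D) {..<NC D} (KC D) \<and> bij_betw (enumI D) {..<NI D} (KI D) \<and>
     grid_point D ` grid_box D \<subseteq> spatial_dom D \<and>
     sigma_a0 D > 0 \<and> (\<forall>z\<in>spatial_dom D. sigma_a D z \<ge> sigma_a0 D) \<and>
     sigma_t0 D > 0 \<and> (\<forall>z\<in>spatial_dom D. sigma_t D z \<ge> sigma_t0 D) \<and>
     product_quadrature (Nq D) (Omega D) (weight D)"

definition wrap_index :: "discretization \<Rightarrow> int \<times> int \<Rightarrow> int \<times> int" where
  "wrap_index D \<kappa> =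
     (lo_x D + (fst \<kappa> - lo_x D) mod (hi_x D - lo_x D + 1),
      lo_y D + (snd \<kappa> - lo_y D) mod (hi_y D - lo_y D + 1))"

text \<open>
  A vector of values at the points \<open>e 0, e 1, ...\<close>, read as a function on the whole doubled
  index lattice: the boundary conditions supply the values at indices outside of the box.
\<close>

definition bc_extend :: "discretization \<Rightarrow> (nat \<Rightarrow> int \<times> int) \<Rightarrow> real vec \<Rightarrow> int \<times> int \<Rightarrow> real" where
  "bc_extend D e u \<kappa> =
     (let \<kappa>' = (case bc D of Zero_bc \<Rightarrow> \<kappa> | Periodic_bc \<Rightarrow> wrap_index D \<kappa>) in
      if \<kappa>' \<in> e ` {..<dim_vec u} then u $ the_inv_into {..<dim_vec u} e \<kappa>' else 0)"

definition spacing :: "discretization \<Rightarrow> axis \<Rightarrow> real" where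
  "spacing D v = (case v of Axis_x \<Rightarrow> dx D | Axis_y \<Rightarrow> dy D)"

definition shift :: "axis \<Rightarrow> int \<Rightarrow> int \<times> int \<Rightarrow> int \<times> int" where
  "shift v m \<kappa> = (case v of Axis_x \<Rightarrow> (fst \<kappa> + m, snd \<kappa>) | Axis_y \<Rightarrow> (fst \<kappa>, snd \<kappa> + m))"

definition op_fwd :: "discretization \<Rightarrow> axis \<Rightarrow> (int \<times> int \<Rightarrow> real) \<Rightarrow> int \<times> int \<Rightarrow> real" where
  "op_fwd D v u \<kappa> = (u (shift v 2 \<kappa>) - u \<kappa>) / spacing D v"

definition op_bwd :: "discretization \<Rightarrow> axis \<Rightarrow> (int \<times> int \<Rightarrow> real) \<Rightarrow> int \<times> int \<Rightarrow> real" where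
  "op_bwd D v u \<kappa> = (u \<kappa> - u (shift v (- 2) \<kappa>)) / spacing D v"

text \<open>
  The two central operators are given by the same formula; they differ in the grids involved.
\<close>

definition op_cen :: "discretization \<Rightarrow> axis \<Rightarrow> (int \<times> int \<Rightarrow> real) \<Rightarrow> int \<times> int \<Rightarrow> real" where
  "op_cen D v u \<kappa> = (u (shift v 1 \<kappa>) - u (shift v (- 1) \<kappa>)) / spacing D v"

text \<open>
  The matrix of a linear operator from grid functions on \<open>ns\<close> points (enumerated by \<open>es\<close>) to
  grid functions on \<open>nt\<close> points (enumerated by \<open>et\<close>).
\<close>

definition matrix_form ::
  "discretization \<Rightarrow> nat \<Rightarrow> (nat \<Rightarrow> int \<times> int) \<Rightarrow> nat \<Rightarrow> (nat \<Rightarrow> int \<times> int) \<Rightarrow>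
   ((int \<times> int \<Rightarrow> real) \<Rightarrow> int \<times> int \<Rightarrow> real) \<Rightarrow> real mat" where
  "matrix_form D nt et ns es A = mat nt ns (\<lambda>(m, l). A (bc_extend D es (unit_vec ns l)) (et m))"

definition Dplus :: "discretization \<Rightarrow> axis \<Rightarrow> real mat" where
  "Dplus D v = matrix_form D (NI D) (enumI D) (NI D) (enumI D) (op_fwd D v)"

definition Dminus :: "discretization \<Rightarrow> axis \<Rightarrow> real mat" where
  "Dminus D v = matrix_form D (NI D) (enumI D) (NI D) (enumI D) (op_bwd D v)"

definition delta0 :: "discretization \<Rightarrow> axis \<Rightarrow> real mat" where
  "delta0 D v = matrix_form D (NI D) (enumI D) (NC D) (enumC D) (op_cen D v)"

definition D0 :: "discretization \<Rightarrow> axis \<Rightarrow> real mat" where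
  "D0 D v = matrix_form D (NC D) (enumC D) (NI D) (enumI D) (op_cen D v)"

definition sum_xy :: "(axis \<Rightarrow> 'a::plus) \<Rightarrow> 'a" where
  "sum_xy f = f Axis_x + f Axis_y"

definition outer :: "real vec \<Rightarrow> real vec \<Rightarrow> real mat" where
  "outer u v = mat (dim_vec u) (dim_vec v) (\<lambda>(i, j). u $ i * v $ j)"

definition SigmaA :: "discretization \<Rightarrow> real mat" where
  "SigmaA D = mat_diag (NC D) (\<lambda>i. sigma_a D (grid_point D (enumC D i)))"

definition SigmaT :: "discretization \<Rightarrow> real mat" where
  "SigmaT D = mat_diag (NI D) (\<lambda>i. sigma_t D (grid_point D (enumI D i)))"

definition SigmaT_inv :: "discretization \<Rightarrow> real mat" where
  "SigmaT_inv D = mat_diag (NI D) (\<lambda>i. 1 / sigma_t D (grid_point D (enumI D i)))"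

definition wvec :: "discretization \<Rightarrow> real vec" where
  "wvec D = vec (Nq D) (weight D)"

definition ones :: "discretization \<Rightarrow> real vec" where
  "ones D = vec (Nq D) (\<lambda>_. 1)"

definition Qmat :: "discretization \<Rightarrow> axis \<Rightarrow> real mat" where
  "Qmat D v = mat_diag (Nq D) (Omega D v)"

definition Qplus :: "discretization \<Rightarrow> axis \<Rightarrow> real mat" where
  "Qplus D v = (1 / 2) \<cdot>\<^sub>m (Qmat D v + map_mat abs (Qmat D v))"

definition Qminus :: "discretization \<Rightarrow> axis \<Rightarrow> real mat" where
  "Qminus D v = (1 / 2) \<cdot>\<^sub>m (Qmat D v - map_mat abs (Qmat D v))"

definition Pmat :: "discretization \<Rightarrow> real mat" where
  "Pmat D = 1\<^sub>m (Nq D) - (1 / (2 * pi)) \<cdot>\<^sub>m outer (ones D) (wvec D)"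

definition Bfun :: "discretization \<Rightarrow> real vec \<Rightarrow> real vec" where
  "Bfun D T = map_vec (\<lambda>t. arad D * clight D / (2 * pi) * t ^ 4) T"

definition scalar_flux :: "discretization \<Rightarrow> real vec \<Rightarrow> real vec \<Rightarrow> real vec" where
  "scalar_flux D T h = Bfun D T + (eps D)\<^sup>2 \<cdot>\<^sub>v h"

definition Lop :: "discretization \<Rightarrow> real mat \<Rightarrow> real mat" where
  "Lop D Y = sum_xy (\<lambda>v. Dplus D v * Y * Qminus D v + Dminus D v * Y * Qplus D v)"

definition Rmat :: "discretization \<Rightarrow> real vec \<Rightarrow> real vec \<Rightarrow> real mat" where
  "Rmat D T h =
     sum_xy (\<lambda>v. outer (delta0 D v *\<^sub>v (Bfun D T + (eps D)\<^sup>2 \<cdot>\<^sub>v h)) (ones D) * Qmat D v)"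

definition orthonormal_cols :: "real mat \<Rightarrow> bool" where
  "orthonormal_cols A \<longleftrightarrow> transpose_mat A * A = 1\<^sub>m (dim_col A)"

abbreviation ran :: "real mat \<Rightarrow> real vec set" where
  "ran A \<equiv> vec_space.col_space (dim_row A) A"

text \<open>
  The scheme prescribes the number of basis vectors: as many as there are given vectors. If these
  are linearly independent, the inclusion of ranges below is an equality and \<open>A\<close> is an
  orthonormal basis of their span. If not, \<open>A\<close> is what a thin QR factorisation returns: an
  orthonormal system of the prescribed size whose span contains all given vectors.
\<close>

definition orthonormal_basis_of :: "real mat \<Rightarrow> nat \<Rightarrow> real vec list \<Rightarrow> bool" where
  "orthonormal_basis_of A n vs \<longleftrightarrow>
     A \<in> carrier_mat n (length vs) \<and> orthonormal_cols A \<and> ran (mat_of_cols n vs) \<subseteq> ran A"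

definition frob_norm :: "real mat \<Rightarrow> real" where
  "frob_norm A = sqrt (\<Sum>i<dim_row A. \<Sum>j<dim_col A. (A $$ (i, j))\<^sup>2)"

definition is_svd :: "real mat \<Rightarrow> nat \<Rightarrow> real mat \<Rightarrow> (nat \<Rightarrow> real) \<Rightarrow> real mat \<Rightarrow> bool" where
  "is_svd M m U s W \<longleftrightarrow>
     U \<in> carrier_mat (dim_row M) m \<and> W \<in> carrier_mat (dim_col M) m \<and>
     orthonormal_cols U \<and> orthonormal_cols W \<and>
     (\<forall>i<m. s i \<ge> 0) \<and> (\<forall>i j. i \<le> j \<and> j < m \<longrightarrow> s j \<le> s i) \<and>
     M = U * mat_diag m s * transpose_mat W"

text \<open>
  \<open>X S V\<^sup>T\<close> (rank \<open>r\<close>) is a conservative truncation of \<open>Xh Sh Vh\<^sup>T\<close> (rank \<open>rh\<close>) with tolerance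
  \<open>tol\<close>, preserving the vectors \<open>ps\<close> in the range of \<open>X\<close> and \<open>qs\<close> in the range of \<open>V\<close>. Some
  directions of the two bases (the columns of \<open>A\<close> and \<open>C\<close>, possibly none) are set aside; of the
  remainder \<open>M\<close>, the leading \<open>k\<close> singular directions are kept, where the discarded singular
  values are below the tolerance. Which directions are set aside depends on the variant of the
  algorithm (only those of \<open>V\<close>, those of both bases, or none with \<open>ps\<close> and \<open>qs\<close> adjoined to the
  bases afterwards), so it is left open.
\<close>

definition conservative_truncation ::
  "real \<Rightarrow> nat \<Rightarrow> real mat \<Rightarrow> real mat \<Rightarrow> real mat \<Rightarrow> real vec list \<Rightarrow> real vec list \<Rightarrow>
   nat \<Rightarrow> real mat \<Rightarrow> real mat \<Rightarrow> real mat \<Rightarrow> bool" where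
  "conservative_truncation tol rh Xh Sh Vh ps qs r X S V \<longleftrightarrow>
     (let G = Xh * Sh * transpose_mat Vh; nx = dim_row Xh; nv = dim_row Vh in
      X \<in> carrier_mat nx r \<and> S \<in> carrier_mat r r \<and> V \<in> carrier_mat nv r \<and>
      1 \<le> r \<and> r < rh \<and>
      orthonormal_cols X \<and> orthonormal_cols V \<and>
      ran X \<subseteq> ran Xh \<and> ran V \<subseteq> ran Vh \<and>
      set ps \<subseteq> ran X \<and> set qs \<subseteq> ran V \<and>
      frob_norm (G - X * S * transpose_mat V) \<le> tol \<and>
      (\<exists>A C m U s W k.
         dim_row A = nx \<and> orthonormal_cols A \<and> ran A \<subseteq> ran Xh \<and>
         dim_row C = nv \<and> orthonormal_cols C \<and> ran C \<subseteq> ran Vh \<and>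
         is_svd ((1\<^sub>m nx - A * transpose_mat A) * G * (1\<^sub>m nv - C * transpose_mat C)) m U s W \<and>
         k \<le> m \<and> sqrt (\<Sum>i\<in>{k..<m}. (s i)\<^sup>2) \<le> tol \<and>
         (\<forall>i<k. col U i \<in> ran X \<and> col W i \<in> ran V)))"

definition ap_vectors_X :: "discretization \<Rightarrow> real vec \<Rightarrow> real vec list" where
  "ap_vectors_X D T =
     [SigmaT_inv D *\<^sub>v (delta0 D Axis_x *\<^sub>v Bfun D T), SigmaT_inv D *\<^sub>v (delta0 D Axis_y *\<^sub>v Bfun D T)]"

definition ap_vectors_V :: "discretization \<Rightarrow> real vec list" where
  "ap_vectors_V D = [Qmat D Axis_x *\<^sub>v ones D, Qmat D Axis_y *\<^sub>v ones D]"

definition pre_augmentation ::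
  "discretization \<Rightarrow> real vec \<Rightarrow> real mat \<Rightarrow> real mat \<Rightarrow> real mat \<Rightarrow> real mat \<Rightarrow> real mat \<Rightarrow> real mat \<Rightarrow> bool" where
  "pre_augmentation D T X S V X' S' V' \<longleftrightarrow>
     orthonormal_basis_of X' (NI D) (ap_vectors_X D T @ cols X) \<and>
     orthonormal_basis_of V' (Nq D) (ap_vectors_V D @ cols V) \<and>
     transpose_mat V' *\<^sub>v wvec D = 0\<^sub>v (dim_col V') \<and>
     S' = transpose_mat X' * X * S * (transpose_mat V * V')"

text \<open>Below, \<open>X0 S0 V0\<^sup>T\<close> is the pre-augmented factorization, of rank \<open>rt\<close>.\<close>

definition K_step ::
  "discretization \<Rightarrow> nat \<Rightarrow> real vec \<Rightarrow> real vec \<Rightarrow> real mat \<Rightarrow> real mat \<Rightarrow> real mat \<Rightarrow>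
   real mat \<Rightarrow> real mat \<Rightarrow> bool" where
  "K_step D rt T h X0 S0 V0 Xt SK \<longleftrightarrow>
     (\<exists>K1 \<in> carrier_mat (NI D) rt.
        let K0 = X0 * S0 in
        ((eps D)\<^sup>2 / (clight D * dt D)) \<cdot>\<^sub>m (K1 - K0) =
          - (eps D \<cdot>\<^sub>m (Lop D (K0 * transpose_mat V0) * transpose_mat (Pmat D) * V0))
          - Rmat D T h * V0 - SigmaT D * K1 \<and>
        Xt \<in> carrier_mat (NI D) rt \<and>
        orthonormal_basis_of (mat_of_cols (NI D) (cols X0 @ cols Xt)) (NI D) (cols X0 @ cols K1) \<and>
        SK = transpose_mat Xt * K1)"

definition L_step ::
  "discretization \<Rightarrow> nat \<Rightarrow> real vec \<Rightarrow> real vec \<Rightarrow> real mat \<Rightarrow> real mat \<Rightarrow> real mat \<Rightarrow>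
   real mat \<Rightarrow> real mat \<Rightarrow> bool" where
  "L_step D rt T h X0 S0 V0 Vt SL \<longleftrightarrow>
     (\<exists>L1 \<in> carrier_mat (Nq D) rt.
        let L0 = V0 * transpose_mat S0 in
        ((eps D)\<^sup>2 / (clight D * dt D)) \<cdot>\<^sub>m (L1 - L0) =
          - (eps D \<cdot>\<^sub>m (Pmat D * transpose_mat (Lop D (X0 * transpose_mat L0)) * X0))
          - transpose_mat (Rmat D T h) * X0 - L1 * (transpose_mat X0 * SigmaT D * X0) \<and>
        Vt \<in> carrier_mat (Nq D) rt \<and>
        orthonormal_basis_of (mat_of_cols (Nq D) (cols V0 @ cols Vt)) (Nq D) (cols V0 @ cols L1) \<and>
        transpose_mat Vt *\<^sub>v wvec D = 0\<^sub>v rt \<and>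
        SL = transpose_mat L1 * Vt)"

definition S_step ::
  "discretization \<Rightarrow> nat \<Rightarrow> real vec \<Rightarrow> real vec \<Rightarrow> real mat \<Rightarrow> real mat \<Rightarrow> real mat \<Rightarrow> real mat \<Rightarrow> bool" where
  "S_step D rt T h X0 S0 V0 Sbar \<longleftrightarrow>
     Sbar \<in> carrier_mat rt rt \<and>
     ((eps D)\<^sup>2 / (clight D * dt D)) \<cdot>\<^sub>m (Sbar - S0) =
       - (eps D \<cdot>\<^sub>m (transpose_mat X0 * Lop D (X0 * S0 * transpose_mat V0)
                      * transpose_mat (Pmat D) * V0))
       - transpose_mat X0 * Rmat D T h * V0
       - transpose_mat X0 * SigmaT D * X0 * Sbar"

text \<open>
  The row of \<open>\<D>\<^sup>0\<^sub>v g\<close> at \<open>\<kappa>\<close>: the operator is applied in space, for each of the \<open>N\<^sub>q\<close> directions.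
\<close>

definition D0_row :: "discretization \<Rightarrow> axis \<Rightarrow> real mat \<Rightarrow> int \<times> int \<Rightarrow> real vec" where
  "D0_row D v g \<kappa> = vec (Nq D) (\<lambda>l. op_cen D v (bc_extend D (enumI D) (col g l)) \<kappa>)"

definition macro_update ::
  "discretization \<Rightarrow> real vec \<Rightarrow> real vec \<Rightarrow> real mat \<Rightarrow> real vec \<Rightarrow> real vec \<Rightarrow> bool" where
  "macro_update D T h g T1 h1 \<longleftrightarrow>
     T1 \<in> carrier_vec (NC D) \<and> h1 \<in> carrier_vec (NC D) \<and>
     (\<forall>\<kappa>\<in>KC D.
        let val = (\<lambda>u. bc_extend D (enumC D) u \<kappa>); \<sigma> = sigma_a D (grid_point D \<kappa>) in
        (eps D)\<^sup>2 / (clight D * dt D) * (val h1 - val h)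
          + 1 / (clight D * dt D) * (val (Bfun D T1) - val (Bfun D T))
          + 1 / (2 * pi) * sum_xy (\<lambda>v. wvec D \<bullet> (Qmat D v *\<^sub>v D0_row D v g \<kappa>))
          = - \<sigma> * val h1 \<and>
        cnu D / dt D * (val T1 - val T) = 2 * pi * \<sigma> * val h1)"

definition bug_step ::
  "discretization \<Rightarrow> real \<Rightarrow>
   nat \<Rightarrow> real vec \<Rightarrow> real vec \<Rightarrow> real mat \<Rightarrow> real mat \<Rightarrow> real mat \<Rightarrow>
   nat \<Rightarrow> real vec \<Rightarrow> real vec \<Rightarrow> real mat \<Rightarrow> real mat \<Rightarrow> real mat \<Rightarrow> bool" where
  "bug_step D tol r T h X S V r1 T1 h1 X1 S1 V1 \<longleftrightarrow>
     T \<in> carrier_vec (NC D) \<and> h \<in> carrier_vec (NC D) \<and>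
     X \<in> carrier_mat (NI D) r \<and> S \<in> carrier_mat r r \<and> V \<in> carrier_mat (Nq D) r \<and>
     orthonormal_cols X \<and> orthonormal_cols V \<and>
     (\<exists>X0 S0 V0 Xt SK Vt SL Sbar.
        let rt = r + 2;
            Xh = mat_of_cols (NI D) (cols X0 @ cols Xt);
            Vh = mat_of_cols (Nq D) (cols V0 @ cols Vt);
            Sh = four_block_mat Sbar SL SK (0\<^sub>m rt rt)
        in
        pre_augmentation D T X S V X0 S0 V0 \<and>
        K_step D rt T h X0 S0 V0 Xt SK \<and>
        L_step D rt T h X0 S0 V0 Vt SL \<and>
        S_step D rt T h X0 S0 V0 Sbar \<and>
        conservative_truncation tol (2 * rt) Xh Sh Vh (ap_vectors_X D T) (ap_vectors_V D)
          r1 X1 S1 V1) \<and>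
     macro_update D T h (X1 * S1 * transpose_mat V1) T1 h1"

end

theory Submission
  imports Defs
begin

text \<open>
  The conservation law is the macroscopic update itself, written with matrices instead of
  point values. The update contains the factorised unknown only through \<open>g = X S V\<^sup>T\<close>, the same
  product after truncation that appears in the conservation law. Since the temperature and
  \<open>h\<close> are updated last, with the flux differences of the truncated \<open>g\<close>, local conservation is
  exact for every truncation tolerance.

  What remains is the passage between the two forms. The left-hand sides match because a grid
  function, extended by the boundary conditions, still has its own values on the grid
  (\<open>bc_extend_KC\<close>). The flux terms match because, for zero as for periodic boundary conditions,
  the extension is linear in the grid values (\<open>bc_extend_unit_vec_sum\<close>), so the matrix of a linear
  difference operator, built from unit vectors, reproduces the operator on every grid
  function (\<open>matrix_form_mult_vec\<close>); and because spatial differencing acts from the left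
  and angular quadrature from the right, so that the two commute (\<open>D0_flux_pointwise\<close>).
\<close>

lemma wrap_index_grid_box:
  assumes "\<kappa> \<in> grid_box D"
  shows "wrap_index D \<kappa> = \<kappa>"
proof -
  have "lo_x D \<le> fst \<kappa>" "fst \<kappa> \<le> hi_x D" "lo_y D \<le> snd \<kappa>" "snd \<kappa> \<le> hi_y D"
    using assms by (auto simp: grid_box_def)
  then show ?thesis
    by (simp add: wrap_index_def)
qed

lemma bc_extend_on_grid:
  assumes "inj_on e {..<dim_vec u}" "i < dim_vec u" "e i \<in> grid_box D"
  shows "bc_extend D e u (e i) = u $ i"
  using assms by (cases "bc D") (auto simp: bc_extend_def wrap_index_grid_box the_inv_into_f_f)

lemma bc_extend_KC:
  assumes "valid_discretization D" "u \<in> carrier_vec (NC D)" "i < NC D"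
  shows "bc_extend D (enumC D) u (enumC D i) = u $ i"
proof (rule bc_extend_on_grid)
  have bij: "bij_betw (enumC D) {..<NC D} (KC D)"
    using assms(1) by (simp add: valid_discretization_def)
  then show "inj_on (enumC D) {..<dim_vec u}"
    using assms(2) by (simp add: bij_betw_def)
  show "enumC D i \<in> grid_box D"
    using bij_betwE[OF bij] assms(3) by (auto simp: KC_def)
  show "i < dim_vec u"
    using assms(2,3) by simp
qed

text \<open>
  Outside of the box either boundary condition supplies a single grid value or zero,
  never a combination with an affine part; this is where linearity comes from.
\<close>

lemma bc_extend_unit_vec_sum:
  assumes "inj_on e {..<n}" "u \<in> carrier_vec n"
  shows "bc_extend D e u \<kappa> = (\<Sum>l<n. u $ l * bc_extend D e (unit_vec n l) \<kappa>)"
proof -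
  define \<kappa>' where "\<kappa>' = (case bc D of Zero_bc \<Rightarrow> \<kappa> | Periodic_bc \<Rightarrow> wrap_index D \<kappa>)"
  have ext: "bc_extend D e v \<kappa> = (if \<kappa>' \<in> e ` {..<n} then v $ the_inv_into {..<n} e \<kappa>' else 0)"
    if "dim_vec v = n" for v
    using that by (simp add: bc_extend_def \<kappa>'_def Let_def)
  show ?thesis
  proof (cases "\<kappa>' \<in> e ` {..<n}")
    case True
    then obtain k where k: "k < n" "\<kappa>' = e k"
      by auto
    then have inv: "the_inv_into {..<n} e \<kappa>' = k"
      using assms(1) by (simp add: the_inv_into_f_f)
    have "(\<Sum>l<n. u $ l * bc_extend D e (unit_vec n l) \<kappa>) = (\<Sum>l<n. if l = k then u $ l else 0)"
      by (rule sum.cong) (use True k(1) in \<open>auto simp: ext inv\<close>)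
    then show ?thesis
      using True k(1) assms(2) by (simp add: ext inv)
  next
    case False
    then show ?thesis
      using assms(2) by (simp add: ext)
  qed
qed

lemma matrix_form_mult_vec:
  assumes linear: "\<And>c f \<kappa>. A (\<lambda>\<kappa>'. \<Sum>l<ns. c l * f l \<kappa>') \<kappa> = (\<Sum>l<ns. c l * A (f l) \<kappa>)"
    and "inj_on es {..<ns}" "u \<in> carrier_vec ns" "i < nt"
  shows "(matrix_form D nt et ns es A *\<^sub>v u) $ i = A (bc_extend D es u) (et i)"
proof -
  have "(matrix_form D nt et ns es A *\<^sub>v u) $ i
      = (\<Sum>l<ns. u $ l * A (bc_extend D es (unit_vec ns l)) (et i))"
    using assms(3,4)
    by (auto simp: matrix_form_def scalar_prod_def atLeast0LessThan mult.commute intro!: sum.cong)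
  also have "\<dots> = A (\<lambda>\<kappa>. \<Sum>l<ns. u $ l * bc_extend D es (unit_vec ns l) \<kappa>) (et i)"
    by (simp add: linear)
  also have "(\<lambda>\<kappa>. \<Sum>l<ns. u $ l * bc_extend D es (unit_vec ns l) \<kappa>) = bc_extend D es u"
    using assms(2,3) by (auto simp: bc_extend_unit_vec_sum[symmetric])
  finally show ?thesis .
qed

lemma op_cen_linear:
  "op_cen D v (\<lambda>\<kappa>'. \<Sum>l\<in>L. c l * f l \<kappa>') \<kappa> = (\<Sum>l\<in>L. c l * op_cen D v (f l) \<kappa>)"
  by (simp add: op_cen_def sum_subtractf[symmetric] sum_divide_distrib right_diff_distrib)

lemma D0_mult_vec:
  assumes "valid_discretization D" "u \<in> carrier_vec (NI D)" "i < NC D"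
  shows "(D0 D v *\<^sub>v u) $ i = op_cen D v (bc_extend D (enumI D) u) (enumC D i)"
proof -
  have "inj_on (enumI D) {..<NI D}"
    using assms(1) by (simp add: valid_discretization_def bij_betw_def)
  then show ?thesis
    unfolding D0_def using assms(2,3) by (intro matrix_form_mult_vec op_cen_linear)
qed

lemma D0_carrier: "D0 D v \<in> carrier_mat (NC D) (NI D)"
  by (simp add: D0_def matrix_form_def)

lemma mat_diag_mult_vec:
  fixes u :: "'a::semiring_1 vec"
  assumes "u \<in> carrier_vec n"
  shows "mat_diag n d *\<^sub>v u = vec n (\<lambda>i. d i * u $ i)"
proof (rule eq_vecI)
  fix i assume "i < dim_vec (vec n (\<lambda>i. d i * u $ i))"
  then have i: "i < n"
    by simp
  have "(mat_diag n d *\<^sub>v u) $ i = (\<Sum>j<n. (if i = j then d j else 0) * u $ j)"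
    using assms i by (simp add: mat_diag_def scalar_prod_def atLeast0LessThan)
  also have "\<dots> = (\<Sum>j<n. if j = i then d i * u $ i else 0)"
    by (rule sum.cong) auto
  finally show "(mat_diag n d *\<^sub>v u) $ i = vec n (\<lambda>i. d i * u $ i) $ i"
    using i by simp
qed (simp add: mat_diag_def)

text \<open>
  By associativity the weights \<open>\<Omega>\<^sub>v\<^sup>l w\<^sup>l\<close> can be collected into one vector, paired with a row
  of \<open>D0 D v * g\<close>; the entries of that row are the differences of the single columns of \<open>g\<close>,
  one for each direction.
\<close>

lemma D0_flux_pointwise:
  assumes "valid_discretization D" "g \<in> carrier_mat (NI D) (Nq D)" "i < NC D"
  shows "((D0 D v * g * Qmat D v) *\<^sub>v wvec D) $ i
    = wvec D \<bullet> (Qmat D v *\<^sub>v D0_row D v g (enumC D i))"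
proof -
  have Q: "Qmat D v \<in> carrier_mat (Nq D) (Nq D)"
    by (simp add: Qmat_def)
  have w: "wvec D \<in> carrier_vec (Nq D)"
    by (simp add: wvec_def)
  have Dg: "D0 D v * g \<in> carrier_mat (NC D) (Nq D)"
    using D0_carrier assms(2) by (rule mult_carrier_mat)
  have Q_mult: "Qmat D v *\<^sub>v u = vec (Nq D) (\<lambda>l. Omega D v l * u $ l)"
    if "u \<in> carrier_vec (Nq D)" for u
    using that by (simp add: Qmat_def mat_diag_mult_vec)
  have entry: "row (D0 D v * g) i $ l = D0_row D v g (enumC D i) $ l" if "l < Nq D" for l
  proof -
    have "col g l \<in> carrier_vec (NI D)"
      using assms(2) that by auto
    then have "(D0 D v *\<^sub>v col g l) $ i = D0_row D v g (enumC D i) $ l"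
      using that by (simp add: D0_mult_vec[OF assms(1) _ assms(3)] D0_row_def)
    moreover have "row (D0 D v * g) i $ l = (D0 D v *\<^sub>v col g l) $ i"
      using that assms(2,3) D0_carrier[of D v] by simp
    ultimately show ?thesis
      by simp
  qed
  have "((D0 D v * g * Qmat D v) *\<^sub>v wvec D) $ i = ((D0 D v * g) *\<^sub>v (Qmat D v *\<^sub>v wvec D)) $ i"
    using assoc_mult_mat_vec[OF Dg Q w] by simp
  also have "\<dots> = (\<Sum>l<Nq D. D0_row D v g (enumC D i) $ l * (Omega D v l * weight D l))"
    unfolding Q_mult[OF w] using D0_carrier[of D v] assms(3) entry
    by (simp add: scalar_prod_def atLeast0LessThan wvec_def del: index_row)
  also have "\<dots> = wvec D \<bullet> (Qmat D v *\<^sub>v D0_row D v g (enumC D i))"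
    by (simp add: Q_mult D0_row_def scalar_prod_def atLeast0LessThan wvec_def ac_simps)
  finally show ?thesis .
qed

lemma SigmaA_mult_vec:
  assumes "u \<in> carrier_vec (NC D)" "i < NC D"
  shows "(SigmaA D *\<^sub>v u) $ i = sigma_a D (grid_point D (enumC D i)) * u $ i"
  using assms by (simp add: SigmaA_def mat_diag_mult_vec)

lemma bug_step_carriers:
  assumes "bug_step D tol r T h X S V r1 T1 h1 X1 S1 V1"
  shows "X1 \<in> carrier_mat (NI D) r1" "S1 \<in> carrier_mat r1 r1" "V1 \<in> carrier_mat (Nq D) r1"
  using assms by (auto simp: bug_step_def conservative_truncation_def Let_def)

text \<open>
  Local conservation is a property of the macroscopic update: read at the point of \<open>KC\<close>
  numbered \<open>i\<close>, each of the two pointwise equations is the \<open>i\<close>-th component of the corresponding vector equation.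
\<close>

lemma macro_update_conservation:
  assumes valid: "valid_discretization D" and upd: "macro_update D T h g T1 h1"
    and T: "T \<in> carrier_vec (NC D)" and h: "h \<in> carrier_vec (NC D)"
    and g: "g \<in> carrier_mat (NI D) (Nq D)"
  shows "(1 / (clight D * dt D)) \<cdot>\<^sub>v (scalar_flux D T1 h1 - scalar_flux D T h)
      + (1 / (2 * pi)) \<cdot>\<^sub>v sum_xy (\<lambda>v. (D0 D v * g * Qmat D v) *\<^sub>v wvec D)
      = - (SigmaA D *\<^sub>v h1)" (is "?lhs = _")
    and "(cnu D / dt D) \<cdot>\<^sub>v (T1 - T) = (2 * pi) \<cdot>\<^sub>v (SigmaA D *\<^sub>v h1)"
proof -
  have T1: "T1 \<in> carrier_vec (NC D)" and h1: "h1 \<in> carrier_vec (NC D)"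
    using upd by (auto simp: macro_update_def)
  have B: "Bfun D u \<in> carrier_vec (NC D)" if "u \<in> carrier_vec (NC D)" for u
    using that by (simp add: Bfun_def)
  have dims: "dim_vec T = NC D" "dim_vec h = NC D" "dim_vec T1 = NC D" "dim_vec h1 = NC D"
    "dim_vec (Bfun D T) = NC D" "dim_vec (Bfun D T1) = NC D"
    "\<And>v. dim_row (D0 D v) = NC D" "dim_row (SigmaA D) = NC D"
    using T h T1 h1 by (auto simp: Bfun_def D0_def matrix_form_def SigmaA_def mat_diag_def)
  have enum: "enumC D i \<in> KC D" if "i < NC D" for i
    using valid that by (auto simp: valid_discretization_def dest: bij_betwE)
  have at_point:
    "(eps D)\<^sup>2 / (clight D * dt D) * (h1 $ i - h $ i)
       + 1 / (clight D * dt D) * (Bfun D T1 $ i - Bfun D T $ i)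
       + 1 / (2 * pi) * sum_xy (\<lambda>v. ((D0 D v * g * Qmat D v) *\<^sub>v wvec D) $ i)
       = - (SigmaA D *\<^sub>v h1) $ i"
    "cnu D / dt D * (T1 $ i - T $ i) = 2 * pi * (SigmaA D *\<^sub>v h1) $ i" if i: "i < NC D" for i
    using upd enum[OF i]
    by (auto simp: macro_update_def Let_def bc_extend_KC[OF valid _ i] T h T1 h1 B
        D0_flux_pointwise[OF valid g i] SigmaA_mult_vec[OF h1 i] dest!: bspec)
  show "?lhs = - (SigmaA D *\<^sub>v h1)"
  proof (rule eq_vecI)
    fix i assume "i < dim_vec (- (SigmaA D *\<^sub>v h1))"
    then have i: "i < NC D"
      by (simp add: dims)
    have "?lhs $ i = 1 / (clight D * dt D)
          * ((Bfun D T1 $ i + (eps D)\<^sup>2 * h1 $ i) - (Bfun D T $ i + (eps D)\<^sup>2 * h $ i))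
        + 1 / (2 * pi) * sum_xy (\<lambda>v. ((D0 D v * g * Qmat D v) *\<^sub>v wvec D) $ i)"
      using i by (simp add: scalar_flux_def sum_xy_def dims del: index_mult_mat_vec)
    also have "\<dots> = - (SigmaA D *\<^sub>v h1) $ i"
      unfolding at_point(1)[OF i, symmetric]
      by (simp add: algebra_simps diff_divide_distrib add_divide_distrib)
    finally show "?lhs $ i = (- (SigmaA D *\<^sub>v h1)) $ i"
      using i by (simp add: dims del: index_mult_mat_vec)
  qed (simp add: scalar_flux_def sum_xy_def dims)
  show "(cnu D / dt D) \<cdot>\<^sub>v (T1 - T) = (2 * pi) \<cdot>\<^sub>v (SigmaA D *\<^sub>v h1)"
    by (rule eq_vecI) (use at_point(2) in \<open>simp_all add: dims del: index_mult_mat_vec\<close>)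
qed

theorem theorem4:
  fixes D :: discretization and tol :: real and r :: "nat \<Rightarrow> nat"
    and T h :: "nat \<Rightarrow> real vec" and X S V :: "nat \<Rightarrow> real mat" and n :: nat
  assumes "valid_discretization D"
    and "bug_step D tol (r n) (T n) (h n) (X n) (S n) (V n)
           (r (Suc n)) (T (Suc n)) (h (Suc n)) (X (Suc n)) (S (Suc n)) (V (Suc n))"
  shows "(1 / (clight D * dt D)) \<cdot>\<^sub>v
             (scalar_flux D (T (Suc n)) (h (Suc n)) - scalar_flux D (T n) (h n))
           + (1 / (2 * pi)) \<cdot>\<^sub>v
             sum_xy (\<lambda>v. (D0 D v * X (Suc n) * S (Suc n) * transpose_mat (V (Suc n)) * Qmat D v)
                          *\<^sub>v wvec D)
           = - (SigmaA D *\<^sub>v h (Suc n))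
         \<and> (cnu D / dt D) \<cdot>\<^sub>v (T (Suc n) - T n) = (2 * pi) \<cdot>\<^sub>v (SigmaA D *\<^sub>v h (Suc n))"
proof -
  let ?g = "X (Suc n) * S (Suc n) * transpose_mat (V (Suc n))"
  note carriers = bug_step_carriers[OF assms(2)]
  have VT: "transpose_mat (V (Suc n)) \<in> carrier_mat (r (Suc n)) (Nq D)"
    using carriers(3) by simp
  have g: "?g \<in> carrier_mat (NI D) (Nq D)"
    using carriers VT by (intro mult_carrier_mat)
  have assoc: "D0 D v * X (Suc n) * S (Suc n) * transpose_mat (V (Suc n)) = D0 D v * ?g" for v
  proof -
    have XS: "X (Suc n) * S (Suc n) \<in> carrier_mat (NI D) (r (Suc n))"
      using carriers by (intro mult_carrier_mat)
    show ?thesis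
      by (simp only: assoc_mult_mat[OF D0_carrier carriers(1,2)] assoc_mult_mat[OF D0_carrier XS VT])
  qed
  have step: "macro_update D (T n) (h n) ?g (T (Suc n)) (h (Suc n))"
    "T n \<in> carrier_vec (NC D)" "h n \<in> carrier_vec (NC D)"
    using assms(2) by (auto simp: bug_step_def)
  show ?thesis
    unfolding assoc using macro_update_conservation[OF assms(1) step g] by blast
qed

end
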